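(* Let $G$ and $H$ be finite simple graphs. If $|V(G)|\le |E(H)|$, then the corona product $G\odot H$, with center graph $G$ and outer graph $H$, admits an antimagic orientation.
   Context: All graphs are finite and simple, and are not assumed to be connected. Corona product: given graphs $G$ and $H$, the corona product $G\odot H$ is the graph obtained by taking one copy of $G$ (the center graph) and $|V(G)|$ disjoint copies of $H$ (the outer graphs), one copy for each vertex of $G$, and joining each vertex of $G$ to every vertex of its corresponding copy of $H$. Explicitly, if $V(G)=\{v_1,\ldots,v_n\}$ and $V(H)=\{u_1,\ldots,u_k\}$, then $V(G\odot H)=\{v_1,\ldots,v_n\}\cup\{u_j^{(i)}\mid 1\le i\le n,\ 1\le j\le k\}$ and $E(G\odot H)=E(G)\cup\{u_j^{(i)}u_{j'}^{(i)}\mid 1\le i\le n,\ u_ju_{j'}\in E(H)\}\cup\{v_iu_j^{(i)}\mid 1\le i\le n,\ 1\le j\le k\}$. Antimagic orientation: let $F$ be a graph, let $D$ be an orientation of $F$ (each edge of $F$ is assigned one of its two directions), and let $\tau:E(F)\to\{1,2,\ldots,|E(F)|\}$ be a bijection. The vertex sum $s_{(D,\tau)}(v)$ of a vertex $v\in V(F)$ is the sum of the labels $\tau(e)$ of all edges $e$ entering $v$ under $D$ minus the sum of the labels $\tau(e)$ of all edges $e$ leaving $v$ under $D$; the vertex sum of an isolated vertex is $0$. The graph $F$ admits an antimagic orientation if there exist an orientation $D$ of $F$ and a bijection $\tau:E(F)\to\{1,2,\ldots,|E(F)|\}$ such that the vertex sums $s_{(D,\tau)}(v)$, $v\in V(F)$,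 are pairwise distinct. *)

theory Defs
  imports "Graph_Theory.Pair_Digraph"
begin

text \<open>
  Finite simple graphs are the instances of \<open>pair_graph\<close>: finite, loop-free digraphs whose arc
  relation is symmetric. An undirected edge is then a pair of opposite arcs; it is identified
  with the set of its two ends, so that \<open>card (uedges G)\<close> is $|E(G)|$ and not twice that number.
\<close>

definition uedges :: "'a pair_pre_digraph \<Rightarrow> 'a set set" where
  "uedges G = {{u, v} | u v. (u, v) \<in> parcs G}"

text \<open>
  In the corona product, \<open>Inl v\<close> is the vertex \<open>v\<close> of the center graph and \<open>Inr (v, u)\<close> is the
  vertex \<open>u\<close> of the copy of \<open>H\<close> belonging to \<open>v\<close>. The last two sets of arcs are the two
  directions of the edges that join \<open>v\<close> to its copy of \<open>H\<close>.
\<close>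

definition corona ::
  "'a pair_pre_digraph \<Rightarrow> 'b pair_pre_digraph \<Rightarrow> ('a + 'a \<times> 'b) pair_pre_digraph" where
  "corona G H = \<lparr>
     pverts = Inl ` pverts G \<union> Inr ` (pverts G \<times> pverts H),
     parcs =
       {(Inl v, Inl w) | v w. (v, w) \<in> parcs G} \<union>
       {(Inr (v, u), Inr (v, u')) | v u u'. v \<in> pverts G \<and> (u, u') \<in> parcs H} \<union>
       {(Inl v, Inr (v, u)) | v u. v \<in> pverts G \<and> u \<in> pverts H} \<union>
       {(Inr (v, u), Inl v) | v u. v \<in> pverts G \<and> u \<in> pverts H}\<rparr>"

text \<open>An orientation retains exactly one of the two arcs of every edge.\<close>

definition is_orientation :: "'a pair_pre_digraph \<Rightarrow> 'a pair_pre_digraph \<Rightarrow> bool" where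
  "is_orientation D F \<longleftrightarrow>
     pverts D = pverts F \<and> parcs D \<subseteq> parcs F \<and>
     (\<forall>u v. (u, v) \<in> parcs F \<longrightarrow> ((u, v) \<in> parcs D \<longleftrightarrow> (v, u) \<notin> parcs D))"

text \<open>Labels are attached to the undirected edges, hence the passage from an arc to its set of ends.\<close>

definition vertex_sum :: "'a pair_pre_digraph \<Rightarrow> ('a set \<Rightarrow> nat) \<Rightarrow> 'a \<Rightarrow> int" where
  "vertex_sum D \<tau> v =
     (\<Sum>e\<in>in_arcs (with_proj D) v. int (\<tau> {fst e, snd e})) -
     (\<Sum>e\<in>out_arcs (with_proj D) v. int (\<tau> {fst e, snd e}))"

definition admits_antimagic_orientation :: "'a pair_pre_digraph \<Rightarrow> bool" where
  "admits_antimagic_orientation F \<longleftrightarrow>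
     (\<exists>D \<tau>. is_orientation D F \<and> bij_betw \<tau> (uedges F) {1..card (uedges F)} \<and>
        inj_on (vertex_sum D \<tau>) (pverts F))"

lemma pair_graph_corona:
  assumes "pair_graph G" and "pair_graph H"
  shows "pair_graph (corona G H)"
proof -
  interpret G: pair_graph G by fact
  interpret H: pair_graph H by fact
  have fin: "finite (pverts (corona G H))"
    by (simp add: corona_def)
  have sub: "parcs (corona G H) \<subseteq> pverts (corona G H) \<times> pverts (corona G H)"
    using G.in_arcsD1 G.in_arcsD2 H.in_arcsD1 H.in_arcsD2
    by (auto simp: corona_def)
  have symG: "(v, u) \<in> parcs G" if "(u, v) \<in> parcs G" for u v
    using G.pair_sym_arcs that by (auto simp: symmetric_def sym_def)
  have symH: "(v, u) \<in> parcs H" if "(u, v) \<in> parcs H" for u v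
    using H.pair_sym_arcs that by (auto simp: symmetric_def sym_def)
  show ?thesis
  proof
    show "finite (parcs (corona G H))"
      using finite_subset[OF sub] fin by simp
    show "symmetric (with_proj (corona G H))"
      by (auto simp: symmetric_def sym_def corona_def symG symH)
    show "fst e \<noteq> snd e" if "e \<in> parcs (corona G H)" for e
      using that G.no_loops' H.no_loops' by (auto simp: corona_def)
  qed (use fin sub in auto)
qed

lemma uedges_corona:
  "uedges (corona G H) =
     {{Inl v, Inl w} | v w. (v, w) \<in> parcs G} \<union>
     {{Inr (v, u), Inr (v, u')} | v u u'. v \<in> pverts G \<and> (u, u') \<in> parcs H} \<union>
     {{Inl v, Inr (v, u)} | v u. v \<in> pverts G \<and> u \<in> pverts H}"
  unfolding uedges_def corona_def by (auto; blast)

end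

theory Submission
  imports Defs
begin

text \<open>
  Write $n = |V(G)|$, $m = |E(G)|$, $k = |V(H)|$, and let $v$ be a vertex of maximum degree $r$ in
  $H$. Every joining edge is directed away from the center, and in every copy of $H$ the vertex
  $v$ is a sink, so that the \<open>r\<close> edges at it, the star, all enter $v$. The labels
  $1, 2, \ldots$ are spent in this order: $G$; the edges of the copies of $H$ outside the stars;
  then, in one range, the stars together with the joining edges that do not end in a copy of $v$;
  finally the $n$ joining edges that end in a copy of $v$.

  Suppose that all edges inside the copies of $H$ have their labels, so that every outer vertex
  has a partial sum. Give larger joining labels to larger partial sums; then the outer sums are
  distinct, whatever set of joining labels is used. Only the copies of $v$ are treated
  differently. They have the largest partial sums, since $r$ star labels outweigh the at most $r$
  smaller labels that can enter another vertex; and the largest $n$ labels are reserved for them.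
  Hence their sums exceed all other outer sums, and it remains to keep them apart from each other.
  For this the stars get $r$ consecutive labels each, with $k - 1$ joining labels in the gap
  between one star and the next. Two of the partial sums then differ by at least
  $r (r + k - 1) \ge r k \ge |E(H)| \ge n$, and so their sums are distinct
  \<^emph>\<open>for every distribution\<close> of the last $n$ labels.

  This freedom is used for the center graph. Once all other labels are fixed, the last $n$ labels
  are distributed in the order that makes the $n$ center sums distinct. A center sum cannot be
  equal to an outer sum either: it contains $k$ large labels with a negative sign, which is enough
  to push it below all outer sums if $G$ contributes at most $m$ to it. An orientation and
  labelling of $G$ with that property exists by a short induction on the number of edges.

  The lemma \<open>ex_bij_inj_sum\<close> distributes labels along partial sums,
  \<open>ex_labelling_net_le_card\<close> treats the center graph, and \<open>ex_outer_labelling\<close> carries out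
  the construction on the copies of $H$ and on the joining edges.
\<close>

section \<open>Labelled orientations as sets of arcs\<close>

definition orients :: "('a \<times> 'a) set \<Rightarrow> ('a \<times> 'a) set \<Rightarrow> bool" where
  "orients A E \<longleftrightarrow> A \<subseteq> E \<and> (\<forall>u v. (u, v) \<in> E \<longrightarrow> ((u, v) \<in> A \<longleftrightarrow> (v, u) \<notin> A))"

text \<open>
  This is the vertex sum for labels that sit on the chosen arcs instead of the undirected edges.
\<close>

definition net :: "('a \<times> 'a) set \<Rightarrow> ('a \<times> 'a \<Rightarrow> nat) \<Rightarrow> 'a \<Rightarrow> int" where
  "net A l v = (\<Sum>e\<in>{e \<in> A. snd e = v}. int (l e)) - (\<Sum>e\<in>{e \<in> A. fst e = v}. int (l e))"

lemma net_cong: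
  assumes "\<And>e. e \<in> A \<Longrightarrow> l e = l' e"
  shows "net A l v = net A l' v"
  unfolding net_def using assms by (intro arg_cong2[where f = "(-)"] sum.cong) auto

text \<open>
  An orientation contains exactly one arc with given ends, so arcs and undirected edges are in
  bijection and labels can be moved from the former to the latter.
\<close>

lemma admits_antimagic_orientationI:
  assumes F: "pair_graph F" and A: "orients A (parcs F)"
    and l: "bij_betw l A {1..card A}" and inj: "inj_on (net A l) (pverts F)"
  shows "admits_antimagic_orientation F"
proof -
  interpret F: pair_graph F by fact
  have sym: "(v, u) \<in> parcs F" if "(u, v) \<in> parcs F" for u v
    using F.pair_sym_arcs that by (auto simp: symmetric_def sym_def)
  have sub: "A \<subseteq> parcs F" and or: "\<And>u v. (u, v) \<in> parcs F \<Longrightarrow> (u, v) \<in> A \<longleftrightarrow> (v, u) \<notin> A"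
    using A by (auto simp: orients_def)
  define ends where "ends = (\<lambda>e :: 'a \<times> 'a. {fst e, snd e})"
  have inj_ends: "inj_on ends A"
  proof (rule inj_onI)
    fix d e assume "d \<in> A" "e \<in> A" "ends d = ends e"
    then show "d = e"
      using sub or by (cases d; cases e) (auto simp: ends_def doubleton_eq_iff)
  qed
  have img: "ends ` A = uedges F"
  proof
    show "ends ` A \<subseteq> uedges F"
      using sub by (force simp: ends_def uedges_def)
    show "uedges F \<subseteq> ends ` A"
    proof
      fix X assume "X \<in> uedges F"
      then obtain u v where X: "X = {u, v}" "(u, v) \<in> parcs F" by (auto simp: uedges_def)
      then consider "(u, v) \<in> A" | "(v, u) \<in> A" using or by blast
      then show "X \<in> ends ` A"
        by cases (use X in \<open>force simp: ends_def insert_commute\<close>)+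
    qed
  qed
  define \<tau> where "\<tau> = l \<circ> the_inv_into A ends"
  have bij_ends: "bij_betw ends A (uedges F)"
    using inj_ends img by (simp add: bij_betw_def)
  have \<tau>: "\<tau> {fst e, snd e} = l e" if "e \<in> A" for e
    using the_inv_into_f_f[OF inj_ends that] by (simp add: \<tau>_def ends_def)
  have bij: "bij_betw \<tau> (uedges F) {1..card (uedges F)}"
    unfolding \<tau>_def using bij_betw_same_card[OF bij_ends] l
    by (auto intro: bij_betw_trans[OF bij_betw_the_inv_into[OF bij_ends]])
  define D where "D = \<lparr>pverts = pverts F, parcs = A\<rparr>"
  have "is_orientation D F"
    using A by (auto simp: is_orientation_def orients_def D_def)
  moreover have "vertex_sum D \<tau> v = net A l v" for v
    unfolding vertex_sum_def net_def in_arcs_def out_arcs_def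
    by (intro arg_cong2[where f = "(-)"] sum.cong) (auto simp: D_def dest: \<tau>)
  ultimately show ?thesis
    unfolding admits_antimagic_orientation_def using bij inj
    by (intro exI[of _ D] exI[of _ \<tau>]) (auto simp: inj_on_def)
qed

section \<open>Distributing labels along partial sums\<close>

text \<open>Give the largest label to an element of largest weight, and proceed with the rest.\<close>

lemma ex_order_preserving_bij:
  fixes p :: "'a \<Rightarrow> int" and X :: "nat set"
  assumes "finite W" and "finite X" and "card W = card X"
  shows "\<exists>x. bij_betw x W X \<and> (\<forall>v\<in>W. \<forall>w\<in>W. p v < p w \<longrightarrow> x v < x w)"
  using assms
proof (induction W arbitrary: X rule: finite_ranking_induct[where f = p])
  case empty
  then show ?case by (auto simp: bij_betw_def)
next
  case (insert w W)
  show ?case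
  proof (cases "w \<in> W")
    case True
    then show ?thesis using insert by (simp add: insert_absorb)
  next
    case False
    have ne: "X \<noteq> {}" using insert.prems insert.hyps False by auto
    define M where "M = Max X"
    have M: "M \<in> X" "\<And>i. i \<in> X \<Longrightarrow> i \<le> M" using ne insert.prems by (auto simp: M_def)
    have "card W = card (X - {M})" using insert.prems insert.hyps False M by simp
    with insert.IH[of "X - {M}"] insert.prems obtain x where
      x: "bij_betw x W (X - {M})" "\<forall>v\<in>W. \<forall>w\<in>W. p v < p w \<longrightarrow> x v < x w" by auto
    define x' where "x' = x(w := M)"
    have "bij_betw x' W (X - {M})"
      using x(1) False by (subst bij_betw_cong[of _ _ x]) (auto simp: x'_def)
    moreover have "bij_betw x' {w} {M}" by (simp add: x'_def bij_betw_def)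
    ultimately have "bij_betw x' (W \<union> {w}) (X - {M} \<union> {M})"
      by (rule bij_betw_combine) auto
    then have bij: "bij_betw x' (insert w W) X" using M by (simp add: insert_absorb)
    have less: "x u < M" if "u \<in> W" for u
      using bij_betwE[OF x(1)] that M(2)[of "x u"] by fastforce
    have "x' a < x' c" if "a \<in> insert w W" "c \<in> insert w W" "p a < p c" for a c
      using that insert.hyps(2) x(2) less False by (fastforce simp: x'_def)
    then show ?thesis using bij by blast
  qed
qed

text \<open>
  Adding labels in the order of the weights keeps different weights apart and separates equal ones.
\<close>

lemma ex_bij_inj_sum:
  fixes p :: "'a \<Rightarrow> int" and X :: "nat set"
  assumes "finite W" and "finite X" and "card W = card X"
  obtains x where "bij_betw x W X" and "inj_on (\<lambda>w. p w + int (x w)) W"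
proof -
  obtain x where x: "bij_betw x W X" "\<forall>v\<in>W. \<forall>w\<in>W. p v < p w \<longrightarrow> x v < x w"
    using ex_order_preserving_bij[OF assms] by blast
  have "inj_on (\<lambda>w. p w + int (x w)) W"
  proof (rule inj_onI)
    fix v w assume vw: "v \<in> W" "w \<in> W" and eq: "p v + int (x v) = p w + int (x w)"
    have "\<not> p v < p w" "\<not> p w < p v" using x(2) vw eq by force+
    then have "x v = x w" using eq by simp
    then show "v = w" using x(1) vw by (auto simp: bij_betw_def inj_on_def)
  qed
  with x(1) that show thesis by blast
qed

section \<open>Labelling the center graph\<close>

lemma net_insert:
  assumes "finite A" and "(c, d) \<notin> A" and "c \<noteq> d"
  shows "net (insert (c, d) A) l v =
    net A l v + (if v = d then int (l (c, d)) else 0) - (if v = c then int (l (c, d)) else 0)"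
proof -
  have "{e \<in> insert (c, d) A. snd e = v} =
      (if v = d then insert (c, d) {e \<in> A. snd e = v} else {e \<in> A. snd e = v})"
    and "{e \<in> insert (c, d) A. fst e = v} =
      (if v = c then insert (c, d) {e \<in> A. fst e = v} else {e \<in> A. fst e = v})"
    by auto
  then show ?thesis using assms by (simp add: net_def)
qed

text \<open>
  The vertex \<open>c\<close> with nonpositive sum makes the induction work. If \<open>c\<close> has an edge, to \<open>d\<close> say,
  then this edge gets the largest label and leaves \<open>c\<close>, and the induction hypothesis is applied to
  the other edges with \<open>d\<close> in the place of \<open>c\<close>: the new label is added to a nonpositive sum at
  \<open>d\<close>, and is subtracted from a smaller sum at \<open>c\<close>. If \<open>c\<close> has no edge, then its sum is \<open>0\<close>
  and the same step is done with an arbitrary edge. In effect, trails are labelled downwards.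
\<close>

lemma ex_labelling_net_le_card:
  assumes "finite E" and "sym E" and "irrefl E"
  shows "\<exists>A l. orients A E \<and> bij_betw l A {1..card A} \<and>
    (\<forall>v. net A l v \<le> int (card A)) \<and> net A l c \<le> 0"
  using assms
proof (induction "card E" arbitrary: E c rule: less_induct)
  case less
  show ?case
  proof (cases "E = {}")
    case True
    then show ?thesis by (intro exI[of _ "{}"]) (auto simp: orients_def net_def bij_betw_def)
  next
    case False
    \<comment> \<open>The arc from \<open>a\<close> to \<open>b\<close> is going to carry the largest label, so it must not enter \<open>c\<close>.\<close>
    obtain a b where ab: "(a, b) \<in> E" and a: "a = c \<or> c \<notin> Field E"
    proof (cases "c \<in> Field E")
      case True
      then obtain d where "(c, d) \<in> E"
        using less.prems(2) by (auto simp: Field_def sym_def)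
      then show ?thesis using that by blast
    next
      case c: False
      obtain a b where "(a, b) \<in> E" using False by auto
      then show ?thesis using that c by blast
    qed
    have ba: "(b, a) \<in> E" and "a \<noteq> b"
      using ab less.prems by (auto simp: sym_def irrefl_def)
    define E' where "E' = E - {(a, b), (b, a)}"
    have "card E' < card E"
      using ab less.prems(1) unfolding E'_def by (intro psubset_card_mono) auto
    moreover have "finite E'" "sym E'" "irrefl E'"
      using less.prems by (auto simp: E'_def sym_def irrefl_def)
    ultimately obtain A l where A: "orients A E'" "bij_betw l A {1..card A}"
      "\<And>v. net A l v \<le> int (card A)" "net A l b \<le> 0"
      using less.hyps[of E' b] by blast
    have subA: "A \<subseteq> E'" using A(1) by (simp add: orients_def)
    then have fin: "finite A" using \<open>finite E'\<close> finite_subset by blast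
    have new: "(a, b) \<notin> A" using subA by (auto simp: E'_def)
    define A' where "A' = insert (a, b) A"
    define l' where "l' = l((a, b) := Suc (card A))"
    have card': "card A' = Suc (card A)" using fin new by (simp add: A'_def)
    have or: "orients A' E"
      using A(1) ab ba \<open>a \<noteq> b\<close> by (auto simp: orients_def A'_def E'_def)
    have "bij_betw l' A {1..card A}"
      using A(2) new by (subst bij_betw_cong[of _ _ l]) (auto simp: l'_def)
    moreover have "bij_betw l' {(a, b)} {Suc (card A)}" by (simp add: l'_def bij_betw_def)
    ultimately have "bij_betw l' (A \<union> {(a, b)}) ({1..card A} \<union> {Suc (card A)})"
      by (rule bij_betw_combine) auto
    moreover have "{1..card A} \<union> {Suc (card A)} = {1..card A'}" by (auto simp: card')
    ultimately have bij: "bij_betw l' A' {1..card A'}" by (simp add: A'_def)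
    have "net A l' v = net A l v" for v
      using new by (intro net_cong) (auto simp: l'_def)
    then have net': "net A' l' v = net A l v + (if v = b then int (Suc (card A)) else 0)
        - (if v = a then int (Suc (card A)) else 0)" for v
      using net_insert[OF fin new \<open>a \<noteq> b\<close>, of l' v] by (simp add: A'_def l'_def)
    have "net A' l' v \<le> int (card A')" for v
      using A(3)[of v] A(4) \<open>a \<noteq> b\<close> by (auto simp: net' card')
    moreover have "net A' l' c \<le> 0"
    proof (cases "a = c")
      case True
      then show ?thesis using A(3)[of c] \<open>a \<noteq> b\<close> by (auto simp: net')
    next
      case False
      then have "c \<notin> Field A'"
        using a False or mono_Field[of A' E] by (auto simp: orients_def)
      then have "{e \<in> A'. snd e = c} = {}" "{e \<in> A'. fst e = c} = {}"
        by (force simp: Field_def)+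
      then show ?thesis by (simp only: net_def)
    qed
    ultimately show ?thesis using or bij by blast
  qed
qed

section \<open>Orientations of the corona product\<close>

definition corona_arcs ::
  "('a \<times> 'a) set \<Rightarrow> 'a set \<Rightarrow> ('b \<times> 'b) set \<Rightarrow> 'b set \<Rightarrow>
    (('a + 'a \<times> 'b) \<times> ('a + 'a \<times> 'b)) set" where
  "corona_arcs A I B V =
     (\<lambda>(a, b). (Inl a, Inl b)) ` A \<union>
     (\<lambda>(a, u, w). (Inr (a, u), Inr (a, w))) ` (I \<times> B) \<union>
     (\<lambda>(a, u). (Inl a, Inr (a, u))) ` (I \<times> V)"

text \<open>
  The argument \<open>g\<close> labels the center graph, \<open>\<mu> a\<close> the copy of the outer graph that belongs to
  \<open>a\<close>, and \<open>y\<close> the joining edges. There is no arc from an outer vertex to the center, so the last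
  value is a dummy.
\<close>

fun corona_label ::
  "('a \<times> 'a \<Rightarrow> nat) \<Rightarrow> ('a \<Rightarrow> 'b \<times> 'b \<Rightarrow> nat) \<Rightarrow> ('a \<times> 'b \<Rightarrow> nat) \<Rightarrow>
    ('a + 'a \<times> 'b) \<times> ('a + 'a \<times> 'b) \<Rightarrow> nat" where
  "corona_label g \<mu> y (Inl a, Inl b) = g (a, b)"
| "corona_label g \<mu> y (Inr (a, u), Inr (b, w)) = \<mu> a (u, w)"
| "corona_label g \<mu> y (Inl a, Inr (b, u)) = y (a, u)"
| "corona_label g \<mu> y (Inr (a, u), Inl b) = 0"

lemma in_corona_arcs_iff [simp]:
  "(Inl a, Inl b) \<in> corona_arcs A I B V \<longleftrightarrow> (a, b) \<in> A"
  "(Inr (a, u), Inr (b, w)) \<in> corona_arcs A I B V \<longleftrightarrow> a = b \<and> a \<in> I \<and> (u, w) \<in> B"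
  "(Inl a, Inr (b, w)) \<in> corona_arcs A I B V \<longleftrightarrow> a = b \<and> a \<in> I \<and> w \<in> V"
  "(Inr (b, w), Inl a) \<notin> corona_arcs A I B V"
  by (auto simp: corona_arcs_def image_iff Bex_def)

lemma net_corona_center:
  assumes "finite V" and "a \<in> I" "finite A"
  shows "net (corona_arcs A I B V) (corona_label g \<mu> y) (Inl a) =
    net A g a - (\<Sum>u\<in>V. int (y (a, u)))"
proof -
  have 1: "{e \<in> corona_arcs A I B V. snd e = Inl a} = (\<lambda>(a, b). (Inl a, Inl b)) ` {e \<in> A. snd e = a}"
    by (auto simp: corona_arcs_def image_iff Bex_def)
  have 2: "{e \<in> corona_arcs A I B V. fst e = Inl a} =
      (\<lambda>(a, b). (Inl a, Inl b)) ` {e \<in> A. fst e = a} \<union> (\<lambda>u. (Inl a, Inr (a, u))) ` V"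
    using assms(2) by (auto simp: corona_arcs_def image_iff Bex_def)
  have 3: "int (corona_label g \<mu> y (case e of (a, b) \<Rightarrow> (Inl a, Inl b))) = int (g e)" for e
    by (cases e) simp
  show ?thesis
    unfolding net_def 1 2 using assms
    by (subst sum.union_disjoint) (auto simp: sum.reindex inj_on_def comp_def 3)
qed

lemma net_corona_outer:
  assumes "finite B" and "a \<in> I" and "u \<in> V"
  shows "net (corona_arcs A I B V) (corona_label g \<mu> y) (Inr (a, u)) =
    net B (\<mu> a) u + int (y (a, u))"
proof -
  have 1: "{e \<in> corona_arcs A I B V. snd e = Inr (a, u)} =
      insert (Inl a, Inr (a, u)) ((\<lambda>(u, w). (Inr (a, u), Inr (a, w))) ` {e \<in> B. snd e = u})"
    using assms(2,3) by (auto simp: corona_arcs_def image_iff Bex_def)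
  have 2: "{e \<in> corona_arcs A I B V. fst e = Inr (a, u)} =
      (\<lambda>(u, w). (Inr (a, u), Inr (a, w))) ` {e \<in> B. fst e = u}"
    using assms(2) by (auto simp: corona_arcs_def image_iff Bex_def)
  have 3: "int (corona_label g \<mu> y (case e of (u, w) \<Rightarrow> (Inr (a, u), Inr (a, w)))) = int (\<mu> a e)" for e
    by (cases e) simp
  show ?thesis
    unfolding net_def 1 2 using assms
    by (subst sum.insert) (auto simp: sum.reindex inj_on_def comp_def 3)
qed

lemma orients_corona_arcs:
  assumes "orients A (parcs G)" and "orients B (parcs H)"
  shows "orients (corona_arcs A (pverts G) B (pverts H)) (parcs (corona G H))"
proof -
  have arcs [simp]:
    "(Inl a, Inl b) \<in> parcs (corona G H) \<longleftrightarrow> (a, b) \<in> parcs G"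
    "(Inr (a, u), Inr (b, w)) \<in> parcs (corona G H) \<longleftrightarrow>
      a = b \<and> a \<in> pverts G \<and> (u, w) \<in> parcs H"
    "(Inl a, Inr (b, w)) \<in> parcs (corona G H) \<longleftrightarrow> a = b \<and> a \<in> pverts G \<and> w \<in> pverts H"
    "(Inr (b, w), Inl a) \<in> parcs (corona G H) \<longleftrightarrow> a = b \<and> a \<in> pverts G \<and> w \<in> pverts H"
    for a b u w
    by (auto simp: corona_def)
  have sub: "A \<subseteq> parcs G" "B \<subseteq> parcs H" using assms by (auto simp: orients_def)
  have one: "orients C E \<Longrightarrow> (a, b) \<in> E \<Longrightarrow> (a, b) \<in> C \<longleftrightarrow> (b, a) \<notin> C"
    for C E :: "('z \<times> 'z) set" and a b
    by (simp add: orients_def)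
  show ?thesis
    unfolding orients_def
  proof (intro conjI subrelI allI impI)
    fix s t
    show "(s, t) \<in> parcs (corona G H)"
      if "(s, t) \<in> corona_arcs A (pverts G) B (pverts H)"
      using sub that by (cases s; cases t) auto
    show "(s, t) \<in> corona_arcs A (pverts G) B (pverts H) \<longleftrightarrow>
        (t, s) \<notin> corona_arcs A (pverts G) B (pverts H)"
      if "(s, t) \<in> parcs (corona G H)"
      using that by (cases s; cases t) (auto dest: one[OF assms(1)] one[OF assms(2)])
  qed
qed

lemma bij_betw_corona_label:
  assumes "bij_betw g A X" and "bij_betw (\<lambda>(a, e). \<mu> a e) (I \<times> B) Y" and "bij_betw y (I \<times> V) Z"
    and "X \<inter> Y = {}" and "(X \<union> Y) \<inter> Z = {}"
  shows "bij_betw (corona_label g \<mu> y) (corona_arcs A I B V) (X \<union> Y \<union> Z)"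
  unfolding corona_arcs_def
proof (intro bij_betw_combine)
  have *: "bij_betw f (h ` S) T" if "bij_betw f' S T" "\<And>s. f (h s) = f' s"
    for f f' h and S :: "'z set" and T
    using that unfolding bij_betw_def inj_on_def by (auto simp: image_comp)
  show "bij_betw (corona_label g \<mu> y) ((\<lambda>(a, b). (Inl a, Inl b)) ` A) X"
    by (rule *[OF assms(1)]) (simp split: prod.split)
  show "bij_betw (corona_label g \<mu> y) ((\<lambda>(a, u, w). (Inr (a, u), Inr (a, w))) ` (I \<times> B)) Y"
    by (rule *[OF assms(2)]) (simp split: prod.split)
  show "bij_betw (corona_label g \<mu> y) ((\<lambda>(a, u). (Inl a, Inr (a, u))) ` (I \<times> V)) Z"
    by (rule *[OF assms(3)]) (simp split: prod.split)
qed (use assms in auto)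

section \<open>Labelling the outer graphs and the joining edges\<close>

text \<open>
  The arc relation \<open>E\<close> is that of the outer graph, \<open>I\<close> is the vertex set of the center graph, and
  the labels up to \<open>m\<close> have been used for the edges of the latter, where they contribute \<open>h a\<close> to
  the sum at \<open>a\<close>. As \<open>h\<close> is given beforehand, the last labels can be chosen depending on it.
\<close>

lemma ex_outer_labelling:
  fixes E :: "('b \<times> 'b) set" and V :: "'b set" and I :: "'a set" and h :: "'a \<Rightarrow> int" and m :: nat
  assumes "finite V" and "E \<subseteq> V \<times> V" and "sym E" and "irrefl E"
    and "finite I" and "I \<noteq> {}" and "card I \<le> card E" and "\<And>a. a \<in> I \<Longrightarrow> h a \<le> int m"
  obtains B \<mu> y X Y where
    "orients B E" "finite B"
    "bij_betw (\<lambda>(a, e). \<mu> a e) (I \<times> B) X" "bij_betw y (I \<times> V) Y"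
    "X \<inter> Y = {}" "X \<union> Y = {m + 1..m + card I * card B + card I * card V}"
    "inj_on (\<lambda>(a, u). net B (\<mu> a) u + int (y (a, u))) (I \<times> V)"
    "inj_on (\<lambda>a. h a - (\<Sum>u\<in>V. int (y (a, u)))) I"
    "\<And>a c u. a \<in> I \<Longrightarrow> c \<in> I \<Longrightarrow> u \<in> V \<Longrightarrow>
       h a - (\<Sum>u\<in>V. int (y (a, u))) < net B (\<mu> c) u + int (y (c, u))"
proof -
  define n k where "n = card I" and "k = card V"
  have finE: "finite E" using assms(1,2) finite_subset by blast
  have "n > 0" using assms(5,6) by (auto simp: n_def card_gt_0_iff)
  then have "E \<noteq> {}" using assms(7) by (auto simp: n_def)
  then obtain a0 b0 where ab0: "(a0, b0) \<in> E" by auto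
  define nbr where "nbr = (\<lambda>u. {w. (w, u) \<in> E})"
  have fin_nbr: "finite (nbr u)" for u
    by (rule finite_subset[OF _ assms(1)]) (use assms(2) in \<open>auto simp: nbr_def\<close>)
  have symE: "(w, u) \<in> E" if "(u, w) \<in> E" for u w using that assms(3) by (rule symD[rotated])
  have loopE: "(u, u) \<notin> E" for u using assms(4) by (simp add: irrefl_def)
  have "V \<noteq> {}" using ab0 assms(2) by auto
  define r where "r = Max ((\<lambda>u. card (nbr u)) ` V)"
  have r_max: "card (nbr u) \<le> r" if "u \<in> V" for u
    using that assms(1) by (auto simp: r_def)
  have "r \<in> (\<lambda>u. card (nbr u)) ` V"
    unfolding r_def using assms(1) \<open>V \<noteq> {}\<close> by (intro Max_in) auto
  then obtain v where v: "v \<in> V" "card (nbr v) = r" by auto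
  have "r > 0"
  proof -
    have "card (nbr b0) > 0" using ab0 fin_nbr by (auto simp: card_gt_0_iff nbr_def)
    then show ?thesis using r_max[of b0] ab0 assms(2) by auto
  qed
  have "k \<ge> 1" using v(1) assms(1) by (auto simp: k_def Suc_le_eq card_gt_0_iff)
  \<comment> \<open>Here the assumption on the number of edges enters: it will keep the sums at the
    copies of \<open>v\<close> apart.\<close>
  have n_le: "n \<le> r * k"
  proof -
    have "E = (\<Union>u\<in>V. (\<lambda>w. (w, u)) ` nbr u)" using assms(2) by (auto simp: nbr_def)
    then have "card E \<le> (\<Sum>u\<in>V. card ((\<lambda>w. (w, u)) ` nbr u))"
      using card_UN_le[OF assms(1)] by metis
    also have "\<dots> \<le> (\<Sum>u\<in>V. r)"
      by (intro sum_mono order_trans[OF card_image_le[OF fin_nbr] r_max])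
    finally show ?thesis using assms(7) by (simp add: n_def k_def mult.commute)
  qed

  \<comment> \<open>Orient along an arbitrary linear order, in which \<open>v\<close> is made the last vertex.\<close>
  obtain f :: "'b \<Rightarrow> nat" where f: "inj_on f V"
    using finite_imp_inj_to_nat_seg[OF assms(1)] by blast
  define B where "B = {(u, w) \<in> E. u \<noteq> v \<and> (w = v \<or> f u < f w)}"
  have or: "orients B E"
    unfolding orients_def
  proof (intro conjI allI impI)
    fix u w assume uw: "(u, w) \<in> E"
    then have "u \<in> V" "w \<in> V" "u \<noteq> w" using assms(2) loopE by auto
    then have "f u \<noteq> f w" using f by (auto simp: inj_on_def)
    then show "(u, w) \<in> B \<longleftrightarrow> (w, u) \<notin> B"
      using uw symE[OF uw] \<open>u \<noteq> w\<close> by (auto simp: B_def)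
  qed (auto simp: B_def)
  have BE: "B \<subseteq> E" by (auto simp: B_def)
  then have finB: "finite B" using finE finite_subset by blast
  have star_iff: "(u, v) \<in> B \<longleftrightarrow> u \<in> nbr v" for u using loopE by (auto simp: B_def nbr_def)

  define S where "S = (\<lambda>u. (u, v)) ` nbr v"
  define Q where "Q = B - S"
  have S: "S = {e \<in> B. snd e = v}" by (auto simp: S_def star_iff)
  have cardS: "card S = r" unfolding S_def using v(2) by (subst card_image) (auto simp: inj_on_def)
  have Q: "Q = {e \<in> B. snd e \<noteq> v}" unfolding Q_def S by auto
  have cardB: "card B = card Q + r"
    unfolding Q_def using finB cardS S by (subst card_Diff_subset) (auto simp: card_mono)
  have sink: "{e \<in> B. fst e = v} = {}" by (auto simp: B_def)

  \<comment> \<open>The labels from \<open>m + 1\<close> to \<open>b\<close> go to the arcs in \<open>Q\<close>, in any order.\<close>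
  define b where "b = m + n * card Q"
  have "card (I \<times> Q) = card {m + 1..b}" by (simp add: b_def n_def card_cartesian_product)
  moreover have "finite (I \<times> Q)" using finB assms(5) by (simp add: Q_def)
  ultimately obtain lo where lo: "bij_betw lo (I \<times> Q) {m + 1..b}"
    using finite_same_card_bij by blast
  \<comment> \<open>The labels from \<open>b + 1\<close> to \<open>c\<close> form \<open>n\<close> blocks of length \<open>d\<close>. Each block starts with the
    \<open>r\<close> labels of one star and goes on with \<open>k - 1\<close> labels for joining edges, so that the stars
    are spread out without any label being lost.\<close>
  define d where "d = r + k - 1"
  have d: "r \<le> d" "d + 1 = r + k" using \<open>r > 0\<close> \<open>k \<ge> 1\<close> by (auto simp: d_def)
  define c where "c = b + n * d"
  obtain \<iota> where \<iota>: "bij_betw \<iota> I {0..<n}"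
    using ex_bij_betw_finite_nat[OF assms(5)] by (auto simp: n_def)
  obtain \<kappa> where \<kappa>: "bij_betw \<kappa> (nbr v) {0..<r}"
    using ex_bij_betw_finite_nat[OF fin_nbr, of v] v(2) by auto
  have \<iota>_less: "\<iota> a < n" if "a \<in> I" for a using bij_betwE[OF \<iota>] that by auto
  have \<kappa>_less: "\<kappa> u < r" if "u \<in> nbr v" for u using bij_betwE[OF \<kappa>] that by auto
  define st where "st = (\<lambda>(a, e :: 'b \<times> 'b). b + 1 + (\<iota> a * d + \<kappa> (fst e)))"
  define L where "L = st ` (I \<times> S)"
  have st_range: "b + 1 \<le> st (a, e)" "st (a, e) \<le> c" if "a \<in> I" "e \<in> S" for a e
  proof -
    have "\<kappa> (fst e) < d" using \<kappa>_less that(2) d(1) by (fastforce simp: S_def)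
    then have "\<iota> a * d + \<kappa> (fst e) < Suc (\<iota> a) * d" by simp
    also have "\<dots> \<le> n * d" using \<iota>_less[OF that(1)] by (intro mult_right_mono) auto
    finally show "st (a, e) \<le> c" by (simp add: st_def c_def)
  qed (simp add: st_def)
  have inj_st: "inj_on st (I \<times> S)"
  proof (rule inj_onI)
    fix s t assume st: "s \<in> I \<times> S" "t \<in> I \<times> S" "st s = st t"
    obtain a u w a' u' w' where st_eq: "s = (a, u, w)" "t = (a', u', w')" by (metis surj_pair)
    with st have *: "a \<in> I" "(u, w) \<in> S" "a' \<in> I" "(u', w') \<in> S"
      "st (a, u, w) = st (a', u', w')" by auto
    then have u: "u \<in> nbr v" "u' \<in> nbr v" "w = v" "w' = v" by (auto simp: S_def)
    then have less: "\<kappa> u < d" "\<kappa> u' < d" using \<kappa>_less d(1) by (meson less_le_trans)+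
    have eq: "\<iota> a * d + \<kappa> u = \<iota> a' * d + \<kappa> u'" using *(5) by (simp add: st_def)
    from arg_cong[OF eq, of "\<lambda>i. i div d"] have "\<iota> a = \<iota> a'" using less by simp
    with eq have "a = a'" "u = u'"
      using *(1,3) u \<iota> \<kappa> by (auto simp: bij_betw_def inj_on_def)
    then show "s = t" using u st_eq by simp
  qed
  have bij_st: "bij_betw st (I \<times> S) L" using inj_st by (simp add: bij_betw_def L_def)
  have cardL: "card L = n * r"
    using bij_betw_same_card[OF bij_st] by (simp add: card_cartesian_product n_def cardS)
  have L_sub: "L \<subseteq> {b + 1..c}" using st_range by (auto simp: L_def)

  define \<mu> where "\<mu> = (\<lambda>a e. if snd e = v then st (a, e) else lo (a, e))"
  have bij_\<mu>: "bij_betw (\<lambda>(a, e). \<mu> a e) (I \<times> B) ({m + 1..b} \<union> L)"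
  proof -
    have "bij_betw (\<lambda>(a, e). \<mu> a e) (I \<times> Q) {m + 1..b}"
      using lo by (subst bij_betw_cong[of _ _ lo]) (auto simp: \<mu>_def Q)
    moreover have "bij_betw (\<lambda>(a, e). \<mu> a e) (I \<times> S) L"
      using bij_st by (subst bij_betw_cong[of _ _ st]) (auto simp: \<mu>_def S)
    ultimately have "bij_betw (\<lambda>(a, e). \<mu> a e) (I \<times> Q \<union> I \<times> S) ({m + 1..b} \<union> L)"
      by (rule bij_betw_combine) (use L_sub in auto)
    moreover have "I \<times> Q \<union> I \<times> S = I \<times> B" by (auto simp: Q S)
    ultimately show ?thesis by simp
  qed
  have \<mu>_lo: "\<mu> a e \<le> b" if "a \<in> I" "e \<in> B" "snd e \<noteq> v" for a e
    using bij_betwE[OF lo] that by (fastforce simp: \<mu>_def Q)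

  \<comment> \<open>The remaining labels \<open>P\<close> of the blocks go to the joining edges that avoid the copies of
    \<open>v\<close>, in the order of the partial sums.\<close>
  define V' where "V' = V - {v}"
  have V': "finite V'" "V = insert v V'" "v \<notin> V'" "card V' = k - 1"
    using v(1) assms(1) by (auto simp: V'_def k_def)
  define P where "P = {b + 1..c} - L"
  have "card P = n * d - n * r"
    unfolding P_def using L_sub by (subst card_Diff_subset) (auto simp: cardL c_def finite_subset)
  also have "\<dots> = n * (k - 1)" using \<open>k \<ge> 1\<close> by (simp add: d_def flip: diff_mult_distrib2)
  finally have cardP: "card (I \<times> V') = card P"
    by (simp add: card_cartesian_product V' n_def)
  obtain x where x: "bij_betw x (I \<times> V') P"
    and inj_x: "inj_on (\<lambda>w. (\<lambda>(a, u). net B (\<mu> a) u) w + int (x w)) (I \<times> V')"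
    using ex_bij_inj_sum[OF _ _ cardP] assms(5) V'(1) by (auto simp: P_def)
  have x_range: "b + 1 \<le> x (a, u)" "x (a, u) \<le> c" if "a \<in> I" "u \<in> V'" for a u
    using bij_betwE[OF x] that by (auto simp: P_def)
  \<comment> \<open>The last \<open>n\<close> labels go to the copies of \<open>v\<close>. They enter the center sums negatively, hence
    the sums to be kept distinct are taken with the opposite sign.\<close>
  have "card I = card {c + 1..c + n}" by (simp add: n_def)
  then obtain \<pi> where \<pi>: "bij_betw \<pi> I {c + 1..c + n}"
    and inj_\<pi>: "inj_on (\<lambda>a. ((\<Sum>u\<in>V'. int (x (a, u))) - h a) + int (\<pi> a)) I"
    using ex_bij_inj_sum[OF assms(5), of "{c + 1..c + n}" "\<lambda>a. (\<Sum>u\<in>V'. int (x (a, u))) - h a"]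
    by auto
  have \<pi>_range: "c + 1 \<le> \<pi> a" "\<pi> a \<le> c + n" if "a \<in> I" for a
    using bij_betwE[OF \<pi>] that by auto
  define y where "y = (\<lambda>(a, u). if u = v then \<pi> a else x (a, u))"
  have bij_y: "bij_betw y (I \<times> V) (P \<union> {c + 1..c + n})"
  proof -
    have "bij_betw y (I \<times> V') P"
      using x V'(3) by (subst bij_betw_cong[of _ _ x]) (auto simp: y_def)
    moreover have "bij_betw y (I \<times> {v}) {c + 1..c + n}"
    proof -
      have "bij_betw (\<pi> \<circ> fst) (I \<times> {v}) {c + 1..c + n}"
        by (rule bij_betw_trans[OF _ \<pi>]) (auto simp: bij_betw_def inj_on_def)
      then show ?thesis by (subst bij_betw_cong[of _ _ "\<pi> \<circ> fst"]) (auto simp: y_def)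
    qed
    ultimately have "bij_betw y (I \<times> V' \<union> I \<times> {v}) (P \<union> {c + 1..c + n})"
      by (rule bij_betw_combine) (auto simp: P_def)
    moreover have "I \<times> V' \<union> I \<times> {v} = I \<times> V" using V'(2) by auto
    ultimately show ?thesis by simp
  qed
  have sum_y: "(\<Sum>u\<in>V. int (y (a, u))) = int (\<pi> a) + (\<Sum>u\<in>V'. int (x (a, u)))" for a
  proof -
    have "(\<Sum>u\<in>V'. int (y (a, u))) = (\<Sum>u\<in>V'. int (x (a, u)))"
      using V'(3) by (intro sum.cong) (auto simp: y_def)
    then show ?thesis using V' by (simp add: y_def)
  qed

  have net_v: "net B (\<mu> a) v = int (r * (b + 1 + \<iota> a * d)) + (\<Sum>u\<in>nbr v. int (\<kappa> u))" for a
  proof -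
    have "net B (\<mu> a) v = (\<Sum>e\<in>S. int (\<mu> a e))"
      unfolding net_def sink S[symmetric] by simp
    also have "\<dots> = (\<Sum>u\<in>nbr v. int (b + 1 + \<iota> a * d) + int (\<kappa> u))"
      unfolding S_def by (subst sum.reindex) (auto simp: inj_on_def \<mu>_def st_def intro!: sum.cong)
    finally show ?thesis using v(2) by (simp add: sum.distrib distrib_left)
  qed
  \<comment> \<open>At most \<open>r\<close> arcs enter \<open>u\<close>, none of them from a star.\<close>
  have net_le: "net B (\<mu> a) u \<le> int (r * b)" if "a \<in> I" "u \<in> V'" for a u
  proof -
    have "card {e \<in> B. snd e = u} \<le> card ((\<lambda>w. (w, u)) ` nbr u)"
      using BE fin_nbr by (intro card_mono) (auto simp: nbr_def)
    also have "\<dots> \<le> r"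
      using that(2) V'(2) by (intro order_trans[OF card_image_le[OF fin_nbr] r_max]) simp
    finally have card: "card {e \<in> B. snd e = u} \<le> r" .
    have "net B (\<mu> a) u \<le> (\<Sum>e\<in>{e \<in> B. snd e = u}. int (\<mu> a e))"
      unfolding net_def by (simp add: sum_nonneg)
    also have "\<dots> \<le> (\<Sum>e\<in>{e \<in> B. snd e = u}. int b)"
      using \<mu>_lo that V'(3) by (intro sum_mono) force
    also have "\<dots> \<le> int (r * b)" using card by (simp add: mult_right_mono)
    finally show ?thesis .
  qed
  \<comment> \<open>At most one arc out of \<open>u\<close> belongs to a star, and at most \<open>k - 2\<close> others leave \<open>u\<close> since
    they avoid both \<open>u\<close> and \<open>v\<close>.\<close>
  have net_ge: "- int c - (int k - 2) * int b \<le> net B (\<mu> a) u" if "a \<in> I" "u \<in> V'" for a u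
  proof -
    let ?O = "{e \<in> B. fst e = u \<and> snd e \<noteq> v}"
    have "?O \<subseteq> Pair u ` (V' - {u})"
    proof
      fix e assume "e \<in> ?O"
      then have e: "e = (u, snd e)" "snd e \<noteq> v" "e \<in> E" using BE by auto
      then have "snd e \<in> V" "snd e \<noteq> u" using assms(2) loopE[of u] by (cases e; auto)+
      with e(2) have "snd e \<in> V' - {u}" by (simp add: V'_def)
      then show "e \<in> Pair u ` (V' - {u})" using e(1) by blast
    qed
    then have "card ?O \<le> card (Pair u ` (V' - {u}))" using V'(1) by (intro card_mono) auto
    also have "\<dots> = k - 2" using V' that(2) by (subst card_image) (auto simp: inj_on_def)
    finally have card: "card ?O \<le> k - 2" .
    have "card V' > 0" using that(2) V'(1) by (auto simp: card_gt_0_iff)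
    then have k2: "int (k - 2) = int k - 2" unfolding V'(4) by simp
    have "(\<Sum>e\<in>?O. int (\<mu> a e)) \<le> (\<Sum>e\<in>?O. int b)"
      using \<mu>_lo that by (intro sum_mono) force
    also have "\<dots> \<le> int (k - 2) * int b" using card by (simp add: mult_right_mono)
    finally have 1: "(\<Sum>e\<in>?O. int (\<mu> a e)) \<le> (int k - 2) * int b" by (simp add: k2)
    have 2: "(\<Sum>e\<in>{e \<in> B. e = (u, v)}. int (\<mu> a e)) \<le> int c"
    proof (cases "(u, v) \<in> B")
      case True
      then have "{e \<in> B. e = (u, v)} = {(u, v)}" by auto
      moreover have "\<mu> a (u, v) \<le> c" using True st_range(2)[OF that(1)] by (simp add: \<mu>_def S)
      ultimately show ?thesis by simp
    next
      case False
      then have "{e \<in> B. e = (u, v)} = {}" by auto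
      then show ?thesis by (simp only:) simp
    qed
    have "{e \<in> B. fst e = u} = ?O \<union> {e \<in> B. e = (u, v)}" by auto
    then have "(\<Sum>e\<in>{e \<in> B. fst e = u}. int (\<mu> a e)) =
        (\<Sum>e\<in>?O. int (\<mu> a e)) + (\<Sum>e\<in>{e \<in> B. e = (u, v)}. int (\<mu> a e))"
      using finB by (simp only:) (subst sum.union_disjoint, auto)
    moreover have "0 \<le> (\<Sum>e\<in>{e \<in> B. snd e = u}. int (\<mu> a e))" by (simp add: sum_nonneg)
    ultimately show ?thesis using 1 2 unfolding net_def by linarith
  qed

  have y_v: "y (a, v) = \<pi> a" for a by (simp add: y_def)
  have y_V': "y (a, u) = x (a, u)" if "u \<in> V'" for a u using that V'(3) by (auto simp: y_def)
  have below: "net B (\<mu> a) u + int (y (a, u)) < net B (\<mu> a') v + int (y (a', v))"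
    if "a \<in> I" "u \<in> V'" "a' \<in> I" for a a' u
  proof -
    have "r * b \<le> r * (b + 1 + \<iota> a' * d)" by (intro mult_left_mono) auto
    moreover have "0 \<le> (\<Sum>u\<in>nbr v. int (\<kappa> u))" by (simp add: sum_nonneg)
    ultimately have "net B (\<mu> a) u \<le> net B (\<mu> a') v"
      using net_le[OF that(1,2)] unfolding net_v by linarith
    moreover have "x (a, u) < \<pi> a'"
      using x_range(2)[OF that(1,2)] \<pi>_range(1)[OF that(3)] by linarith
    ultimately show ?thesis using that(2) by (simp add: y_v y_V')
  qed
  \<comment> \<open>The partial sums at two copies of \<open>v\<close> differ by at least \<open>r * d \<ge> n\<close>, and their joining
    labels by less than \<open>n\<close>.\<close>
  have increasing: "net B (\<mu> a) v + int (y (a, v)) < net B (\<mu> a') v + int (y (a', v))"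
    if "a \<in> I" "a' \<in> I" "\<iota> a < \<iota> a'" for a a'
  proof -
    have "n \<le> r * d" using n_le mult_le_mono2[of k d r] d(2) \<open>r > 0\<close> by linarith
    have "Suc (\<iota> a) * d \<le> \<iota> a' * d" using that(3) by (intro mult_right_mono) auto
    then have "r * (b + 1 + \<iota> a * d + d) \<le> r * (b + 1 + \<iota> a' * d)"
      by (intro mult_left_mono) auto
    then have "r * (b + 1 + \<iota> a * d) + n \<le> r * (b + 1 + \<iota> a' * d)"
      using \<open>n \<le> r * d\<close> by (simp add: distrib_left)
    then show ?thesis
      using \<pi>_range[OF that(1)] \<pi>_range[OF that(2)] unfolding net_v y_v by linarith
  qed
  have inj_outer: "inj_on (\<lambda>(a, u). net B (\<mu> a) u + int (y (a, u))) (I \<times> V)"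
  proof (rule inj_onI)
    fix s t
    assume st: "s \<in> I \<times> V" "t \<in> I \<times> V"
      "(case s of (a, u) \<Rightarrow> net B (\<mu> a) u + int (y (a, u))) =
       (case t of (a, u) \<Rightarrow> net B (\<mu> a) u + int (y (a, u)))"
    obtain a u a' u' where st_eq: "s = (a, u)" "t = (a', u')" by fastforce
    with st have *: "a \<in> I" "u \<in> V" "a' \<in> I" "u' \<in> V"
      and eq: "net B (\<mu> a) u + int (y (a, u)) = net B (\<mu> a') u' + int (y (a', u'))" by auto
    consider "u = v" "u' = v" | "u = v" "u' \<in> V'" | "u \<in> V'" "u' = v" | "u \<in> V'" "u' \<in> V'"
      using *(2,4) V'(2) by blast
    then have "a = a' \<and> u = u'"
    proof cases
      case 1
      then have "\<iota> a = \<iota> a'"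
        using increasing[OF *(1,3)] increasing[OF *(3,1)] eq by (metis less_irrefl linorder_neqE_nat)
      then show ?thesis using 1 * \<iota> by (auto simp: bij_betw_def inj_on_def)
    next
      case 2
      then show ?thesis using below[OF *(3) _ *(1)] eq by fastforce
    next
      case 3
      then show ?thesis using below[OF *(1) _ *(3)] eq by fastforce
    next
      case 4
      then show ?thesis using inj_onD[OF inj_x, of "(a, u)" "(a', u')"] * eq by (simp add: y_V')
    qed
    then show "s = t" by (simp add: st_eq)
  qed
  have inj_center: "inj_on (\<lambda>a. h a - (\<Sum>u\<in>V. int (y (a, u)))) I"
    using inj_\<pi> unfolding inj_on_def sum_y by (smt (verit))
  \<comment> \<open>A center sum contains the negatives of a label above \<open>c\<close> and of \<open>k - 1\<close> labels above
    \<open>b\<close>. An outer sum away from \<open>v\<close> loses, by \<open>net_ge\<close>, at most \<open>c\<close> and \<open>k - 2\<close> labels up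
    to \<open>b\<close>, and at a copy of \<open>v\<close> nothing is lost. The difference is more than \<open>b\<close>, hence more than the contribution of the center graph.\<close>
  have center_less: "h a - (\<Sum>u\<in>V. int (y (a, u))) < net B (\<mu> a') u + int (y (a', u))"
    if "a \<in> I" "a' \<in> I" "u \<in> V" for a a' u
  proof -
    have "(\<Sum>u\<in>V'. int b + 1) \<le> (\<Sum>u\<in>V'. int (x (a, u)))"
      using x_range(1)[OF that(1)] by (intro sum_mono) force
    then have "(int k - 1) * (int b + 1) \<le> (\<Sum>u\<in>V'. int (x (a, u)))"
      using V'(4) \<open>k \<ge> 1\<close> by (simp add: of_nat_diff)
    then have *: "h a - (\<Sum>u\<in>V. int (y (a, u))) \<le> int m - (int c + 1) - (int k - 1) * (int b + 1)"
      using assms(8)[OF that(1)] \<pi>_range(1)[OF that(1)] unfolding sum_y by linarith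
    have "m \<le> b" by (simp add: b_def)
    show ?thesis
    proof (cases "u = v")
      case True
      have "0 \<le> (int k - 1) * (int b + 1)" using \<open>k \<ge> 1\<close> by (intro mult_nonneg_nonneg) auto
      moreover have "0 \<le> (\<Sum>u\<in>nbr v. int (\<kappa> u))" by (simp add: sum_nonneg)
      moreover have "b \<le> c" by (simp add: c_def)
      ultimately show ?thesis using * \<open>m \<le> b\<close> unfolding True net_v by linarith
    next
      case False
      then have "u \<in> V'" using that(3) V'(2) by simp
      moreover have "(int k - 1) * (int b + 1) = (int k - 2) * int b + int b + (int k - 1)"
        by (simp add: algebra_simps)
      ultimately show ?thesis using * \<open>m \<le> b\<close> net_ge[OF that(2), of u] \<open>k \<ge> 1\<close> by linarith
    qed
  qed
  have top: "c + n = m + card I * card B + card I * card V"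
  proof -
    have "n * d + n = n * r + n * k"
      using arg_cong[OF d(2), of "\<lambda>i. n * i"] by (simp add: distrib_left)
    then show ?thesis
      by (simp add: c_def b_def cardB distrib_left flip: n_def k_def)
  qed
  show thesis
  proof (rule that[OF or finB bij_\<mu> bij_y _ _ inj_outer inj_center center_less])
    show "({m + 1..b} \<union> L) \<inter> (P \<union> {c + 1..c + n}) = {}"
      using L_sub by (auto simp: P_def c_def)
    have "m \<le> b" "b \<le> c" by (simp_all add: b_def c_def)
    then show "{m + 1..b} \<union> L \<union> (P \<union> {c + 1..c + n}) =
        {m + 1..m + card I * card B + card I * card V}"
      using L_sub unfolding top[symmetric] P_def by auto
  qed
qed

theorem theorem4p3:
  fixes G :: "'a pair_pre_digraph" and H :: "'b pair_pre_digraph"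
  assumes "pair_graph G" and "pair_graph H"
    and "card (pverts G) \<le> card (uedges H)"
  shows "admits_antimagic_orientation (corona G H)"
proof -
  interpret G: pair_graph G by fact
  interpret H: pair_graph H by fact
  let ?I = "pverts G" and ?V = "pverts H"
  have EG: "finite (parcs G)" "sym (parcs G)" "irrefl (parcs G)"
    using G.pair_sym_arcs G.no_loops' by (auto simp: symmetric_def irrefl_def)
  have EH: "parcs H \<subseteq> ?V \<times> ?V" "sym (parcs H)" "irrefl (parcs H)"
    using H.pair_sym_arcs H.no_loops' H.in_arcsD1 H.in_arcsD2
    by (auto simp: symmetric_def irrefl_def)
  obtain A g where A: "orients A (parcs G)" and g: "bij_betw g A {1..card A}"
    and le: "\<And>v. net A g v \<le> int (card A)"
    using ex_labelling_net_le_card[OF EG] by blast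
  have finA: "finite A" using A EG(1) by (auto simp: orients_def intro: finite_subset)
  show ?thesis
  proof (cases "?I = {}")
    case True
    then have "pverts (corona G H) = {}" by (simp add: corona_def)
    moreover from this have "parcs (corona G H) = {}"
      using True G.in_arcsD1 by (auto simp: corona_def)
    ultimately show ?thesis
      by (intro admits_antimagic_orientationI[OF pair_graph_corona[OF assms(1,2)], of "{}"])
        (auto simp: orients_def bij_betw_def)
  next
    case False
    have "uedges H = (\<lambda>(u, v). {u, v}) ` parcs H" by (auto simp: uedges_def)
    then have card_le: "card ?I \<le> card (parcs H)"
      using assms(3) card_image_le[OF H.pair_finite_arcs] by (metis le_trans)
    obtain B \<mu> y X Y where B: "orients B (parcs H)" "finite B"
      and bij: "bij_betw (\<lambda>(a, e). \<mu> a e) (?I \<times> B) X" "bij_betw y (?I \<times> ?V) Y"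
      and XY: "X \<inter> Y = {}" "X \<union> Y = {card A + 1..card A + card ?I * card B + card ?I * card ?V}"
      and inj: "inj_on (\<lambda>(a, u). net B (\<mu> a) u + int (y (a, u))) (?I \<times> ?V)"
        "inj_on (\<lambda>a. net A g a - (\<Sum>u\<in>?V. int (y (a, u)))) ?I"
      and less: "\<And>a c u. a \<in> ?I \<Longrightarrow> c \<in> ?I \<Longrightarrow> u \<in> ?V \<Longrightarrow>
        net A g a - (\<Sum>u\<in>?V. int (y (a, u))) < net B (\<mu> c) u + int (y (c, u))"
      by (rule ex_outer_labelling[where h = "net A g", OF H.pair_finite_verts EH
            G.pair_finite_verts False card_le le], rule that)
    let ?D = "corona_arcs A ?I B ?V" and ?l = "corona_label g \<mu> y"
    have "{1..card A} \<inter> (X \<union> Y) = {}" unfolding XY(2) by auto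
    then have l: "bij_betw ?l ?D ({1..card A} \<union> X \<union> Y)"
      using XY(1) by (intro bij_betw_corona_label g bij) auto
    moreover have range: "{1..card A} \<union> X \<union> Y = {1..card A + card ?I * card B + card ?I * card ?V}"
      unfolding Un_assoc XY(2) by auto
    ultimately have l: "bij_betw ?l ?D {1..card ?D}"
      using bij_betw_same_card[OF l] by simp
    have center: "net ?D ?l (Inl a) = net A g a - (\<Sum>u\<in>?V. int (y (a, u)))" if "a \<in> ?I" for a
      using that by (intro net_corona_center finA) auto
    have outer: "net ?D ?l (Inr (a, u)) = net B (\<mu> a) u + int (y (a, u))"
      if "a \<in> ?I" "u \<in> ?V" for a u
      using that by (intro net_corona_outer B(2))
    have "inj_on (net ?D ?l) (Inl ` ?I \<union> Inr ` (?I \<times> ?V))"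
    proof (rule inj_onI)
      fix s t assume st: "s \<in> Inl ` ?I \<union> Inr ` (?I \<times> ?V)" "t \<in> Inl ` ?I \<union> Inr ` (?I \<times> ?V)"
        and eq: "net ?D ?l s = net ?D ?l t"
      show "s = t"
      proof (cases s; cases t)
        fix a c assume "s = Inl a" "t = Inl c"
        then show ?thesis using st eq inj_onD[OF inj(2), of a c] by (auto simp: center)
      next
        fix a w assume "s = Inl a" "t = Inr w"
        then show ?thesis using st eq less[of a "fst w" "snd w"] by (auto simp: center outer)
      next
        fix a w assume "s = Inr w" "t = Inl a"
        then show ?thesis using st eq less[of a "fst w" "snd w"] by (auto simp: center outer)
      next
        fix w z assume "s = Inr w" "t = Inr z"
        then show ?thesis using st eq inj_onD[OF inj(1), of w z] by (auto simp: outer)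
      qed
    qed
    then show ?thesis
      by (intro admits_antimagic_orientationI[OF pair_graph_corona[OF assms(1,2)] _ l]
          orients_corona_arcs A B(1)) (simp add: corona_def)
  qed
qed

end
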